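(* Suppose that $A,B,X,Y\in \mathbb{C}^{n\times n}$ are all Hermitian positive semi-definite. Let $$T=(A+B):(X+Y),\qquad H=(A+X):(B+Y)-A:B-X:Y.$$ Then $$H=\big[(A+B)^\dagger B-(X+Y)^\dagger Y\big]^*\cdot T\cdot\big[(A+B)^\dagger B-(X+Y)^\dagger Y\big].$$
   Context: $\mathbb{C}^{n\times n}$ is the set of $n\times n$ complex matrices; $M^*$ is the conjugate transpose of $M$. $M^\dagger$ denotes the Moore-Penrose inverse of $M$, i.e. the unique matrix satisfying $MM^\dagger M=M$, $M^\dagger MM^\dagger=M^\dagger$, $(MM^\dagger)^*=MM^\dagger$, $(M^\dagger M)^*=M^\dagger M$. The parallel sum of Hermitian positive semi-definite matrices $P,Q\in\mathbb{C}^{n\times n}$ is $P:Q=P(P+Q)^\dagger Q$. *)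

theory Defs
  imports "HOL-Analysis.Analysis"
begin

definition conj_transpose :: "complex^'n^'m \<Rightarrow> complex^'m^'n" where
  "conj_transpose M = transpose (map_matrix cnj M)"

definition hermitian :: "complex^'n^'n \<Rightarrow> bool" where
  "hermitian M \<longleftrightarrow> conj_transpose M = M"

text \<open>For Hermitian \<open>M\<close> the form \<open>x\<^sup>* M x\<close> is real, so \<open>Re\<close> loses nothing.\<close>

definition hermitian_psd :: "complex^'n^'n \<Rightarrow> bool" where
  "hermitian_psd M \<longleftrightarrow>
     hermitian M \<and> (\<forall>x. 0 \<le> Re (\<Sum>i\<in>UNIV. cnj (x $ i) * (M *v x) $ i))"

definition is_mp_inverse :: "complex^'n^'m \<Rightarrow> complex^'m^'n \<Rightarrow> bool" where
  "is_mp_inverse M N \<longleftrightarrow>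
     M ** N ** M = M \<and>
     N ** M ** N = N \<and>
     conj_transpose (M ** N) = M ** N \<and>
     conj_transpose (N ** M) = N ** M"

definition mp_inverse :: "complex^'n^'m \<Rightarrow> complex^'m^'n" where
  "mp_inverse M = (THE N. is_mp_inverse M N)"

definition parallel_sum :: "complex^'n^'n \<Rightarrow> complex^'n^'n \<Rightarrow> complex^'n^'n" where
  "parallel_sum P Q = P ** mp_inverse (P + Q) ** Q"

end

theory Submission
  imports Defs
begin

text \<open>
  For Hermitian positive semi-definite \<open>A\<close>, \<open>B\<close> the kernel of \<open>P = A + B\<close> lies in that of \<open>B\<close>,
  so \<open>P P\<^sup>\<dagger> B = B = B P\<^sup>\<dagger> P\<close> and hence \<open>A : B = B - B P\<^sup>\<dagger> B\<close>. With \<open>Q = X + Y\<close>, \<open>S = P + Q\<close>,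
  \<open>C = P\<^sup>\<dagger> B\<close> and \<open>D = Q\<^sup>\<dagger> Y\<close> we have \<open>B = P C = C\<^sup>* P\<close> and \<open>Y = Q D = D\<^sup>* Q\<close>, and therefore
  \<open>H = C\<^sup>* P C + D\<^sup>* Q D - (P C + Q D)\<^sup>* S\<^sup>\<dagger> (P C + Q D)\<close>. This equals \<open>(C - D)\<^sup>* T (C - D)\<close> because
  \<open>T = P - P S\<^sup>\<dagger> P = Q - Q S\<^sup>\<dagger> Q = P S\<^sup>\<dagger> Q = Q S\<^sup>\<dagger> P\<close>.
\<close>

section \<open>Adjoints and matrix algebra\<close>

lemma conj_transpose_nth [simp]: "conj_transpose M $ i $ j = cnj (M $ j $ i)"
  by (simp add: conj_transpose_def transpose_def map_matrix_def)

lemma conj_transpose_conj_transpose [simp]: "conj_transpose (conj_transpose M) = M"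
  by (simp add: vec_eq_iff)

lemma conj_transpose_add: "conj_transpose (M + N) = conj_transpose M + conj_transpose N"
  by (simp add: vec_eq_iff)

lemma conj_transpose_diff: "conj_transpose (M - N) = conj_transpose M - conj_transpose N"
  by (simp add: vec_eq_iff)

lemma conj_transpose_mult: "conj_transpose (M ** N) = conj_transpose N ** conj_transpose M"
  by (simp add: vec_eq_iff matrix_matrix_mult_def mult.commute)

lemma matrix_diff_ldistrib: "A ** (B - C) = A ** B - A ** C"
  for A :: "'a::ring_1 ^ 'n ^ 'm"
  by (simp add: vec_eq_iff matrix_matrix_mult_def right_diff_distrib sum_subtractf)

lemma matrix_diff_rdistrib: "(A - B) ** C = A ** C - B ** C"
  for A :: "'a::ring_1 ^ 'n ^ 'm"
  by (simp add: vec_eq_iff matrix_matrix_mult_def left_diff_distrib sum_subtractf)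

lemma matrix_add_rdistrib: "(A + B) ** C = A ** C + B ** C"
  for A :: "'a::semiring_1 ^ 'n ^ 'm"
  by (simp add: vec_eq_iff matrix_matrix_mult_def distrib_right sum.distrib)

text \<open>Links the form in \<open>hermitian_psd\<close> to the real inner product of the library,
  so that positivity arguments can use real bilinearity.\<close>

lemma inner_complex_vec: "x \<bullet> y = Re (\<Sum>i\<in>UNIV. cnj (x $ i) * y $ i)"
  for x y :: "complex^'n"
  by (simp add: inner_vec_def inner_complex_def)

lemma inner_matrix_vector_mult:
  fixes M :: "complex^'n^'m"
  shows "x \<bullet> (M *v y) = (conj_transpose M *v x) \<bullet> y"
proof -
  have "(\<Sum>i\<in>UNIV. cnj (x $ i) * (M *v y) $ i)
      = (\<Sum>i\<in>UNIV. \<Sum>j\<in>UNIV. cnj (x $ i) * (M $ i $ j * y $ j))"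
    by (simp add: matrix_vector_mult_def sum_distrib_left)
  also have "\<dots> = (\<Sum>j\<in>UNIV. \<Sum>i\<in>UNIV. cnj (x $ i) * (M $ i $ j * y $ j))"
    by (rule sum.swap)
  also have "\<dots> = (\<Sum>j\<in>UNIV. cnj ((conj_transpose M *v x) $ j) * y $ j)"
    by (simp add: matrix_vector_mult_def sum_distrib_left mult_ac)
  finally show ?thesis
    by (simp only: inner_complex_vec)
qed

section \<open>Kernels of positive semi-definite matrices\<close>

lemma hermitian_psd_iff_inner:
  "hermitian_psd M \<longleftrightarrow> hermitian M \<and> (\<forall>x. 0 \<le> x \<bullet> (M *v x))"
  by (simp only: hermitian_psd_def inner_complex_vec)

lemma hermitian_psd_add:
  assumes "hermitian_psd M" "hermitian_psd N"
  shows "hermitian_psd (M + N)"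
  using assms
  by (simp add: hermitian_psd_iff_inner hermitian_def conj_transpose_add
      matrix_vector_mult_add_rdistrib inner_add_right)

text \<open>If \<open>y = M *v x\<close> were nonzero, moving from \<open>x\<close> a little in the
  direction \<open>-y\<close> would make the quadratic form negative.\<close>

lemma hermitian_psd_kernel:
  fixes M :: "complex^'n^'n"
  assumes "hermitian_psd M" "x \<bullet> (M *v x) = 0"
  shows "M *v x = 0"
proof (rule ccontr)
  assume nz: "M *v x \<noteq> 0"
  define y where "y = M *v x"
  define c where "c = y \<bullet> (M *v y)"
  define d where "d = y \<bullet> y"
  have d: "d > 0"
    using nz by (simp add: d_def y_def)
  have "c \<ge> 0" "conj_transpose M = M"
    using assms(1) by (auto simp: hermitian_psd_iff_inner c_def hermitian_def)
  have xy: "x \<bullet> (M *v y) = d"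
    by (simp add: inner_matrix_vector_mult \<open>conj_transpose M = M\<close> d_def flip: y_def)
  have quad: "0 \<le> t * (t * c - 2 * d)" for t
  proof -
    have "0 \<le> (x - t *\<^sub>R y) \<bullet> (M *v (x - t *\<^sub>R y))"
      using assms(1) by (simp add: hermitian_psd_iff_inner)
    also have "M *v (x - t *\<^sub>R y) = y - t *\<^sub>R (M *v y)"
      by (simp add: matrix_vector_mult_diff_distrib linear_scale[OF matrix_vector_mul_linear] y_def)
    also have "(x - t *\<^sub>R y) \<bullet> (y - t *\<^sub>R (M *v y)) = t * (t * c - 2 * d)"
      using assms(2) xy
      by (simp add: inner_diff_left inner_diff_right c_def d_def algebra_simps flip: y_def)
    finally show ?thesis .
  qed
  \<comment> \<open>Any t > 0 with t * c < 2 * d violates \<open>quad\<close>; the denominator c + 1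
    also covers c = 0.\<close>
  have "d / (c + 1) * (d / (c + 1) * c - 2 * d) < 0"
  proof (rule mult_pos_neg)
    have "d / (c + 1) * c \<le> d"
      using \<open>c \<ge> 0\<close> d by (simp add: field_simps)
    then show "d / (c + 1) * c - 2 * d < 0"
      using d by linarith
  qed (use \<open>c \<ge> 0\<close> d in simp)
  with quad[of "d / (c + 1)"] show False
    by linarith
qed

lemma hermitian_psd_add_kernel:
  fixes A B :: "complex^'n^'n"
  assumes "hermitian_psd A" "hermitian_psd B" "(A + B) *v x = 0"
  shows "B *v x = 0"
proof (rule hermitian_psd_kernel[OF assms(2)])
  have "x \<bullet> (A *v x) + x \<bullet> (B *v x) = x \<bullet> ((A + B) *v x)"
    by (simp add: matrix_vector_mult_add_rdistrib inner_add_right)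
  moreover have "x \<bullet> (A *v x) \<ge> 0" "x \<bullet> (B *v x) \<ge> 0"
    using assms by (auto simp: hermitian_psd_iff_inner)
  ultimately show "x \<bullet> (B *v x) = 0"
    using assms(3) by simp
qed

text \<open>The kernel inclusion in matrix form: an equation between multiples of
  \<open>A + B\<close> passes to \<open>B\<close> by taking \<open>Z\<close> to be a
  difference.\<close>

lemma hermitian_psd_add_mult_eq_0:
  fixes A B :: "complex^'n^'n" and Z :: "complex^'k^'n"
  assumes "hermitian_psd A" "hermitian_psd B" "(A + B) ** Z = 0"
  shows "B ** Z = 0"
proof -
  have "(B ** Z) *v v = 0" for v
    using hermitian_psd_add_kernel[OF assms(1,2), of "Z *v v"] assms(3)
    by (simp add: matrix_vector_mul_assoc)
  then show ?thesis
    by (simp add: matrix_eq)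
qed

section \<open>Moore-Penrose inverses of Hermitian matrices\<close>

lemma is_mp_inverse_unique:
  fixes M :: "complex^'n^'m"
  assumes "is_mp_inverse M N" "is_mp_inverse M N'"
  shows "N = N'"
proof -
  have [simp]: "M ** N ** M = M" "N ** M ** N = N" "M ** N' ** M = M" "N' ** M ** N' = N'"
    using assms by (auto simp: is_mp_inverse_def)
  \<comment> \<open>Both \<open>M ** N\<close> and \<open>M ** N'\<close> are Hermitian and each
    absorbs the other on its right, so taking the adjoint of their product identifies them.\<close>
  have "M ** N = conj_transpose ((M ** N') ** (M ** N))"
    using assms by (simp add: matrix_mul_assoc is_mp_inverse_def)
  also have "\<dots> = (M ** N) ** (M ** N')"
    using assms by (simp only: conj_transpose_mult[of "M ** N'"] is_mp_inverse_def)
  finally have left: "M ** N = M ** N'"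
    by (simp add: matrix_mul_assoc)
  have "N ** M = conj_transpose ((N ** M) ** (N' ** M))"
    using assms by (metis matrix_mul_assoc is_mp_inverse_def)
  also have "\<dots> = (N' ** M) ** (N ** M)"
    using assms by (simp only: conj_transpose_mult[of "N ** M"] is_mp_inverse_def)
  also have "\<dots> = N' ** (M ** N ** M)"
    by (simp only: matrix_mul_assoc)
  finally have right: "N ** M = N' ** M"
    by simp
  have "N = N ** M ** N"
    by simp
  also have "\<dots> = N' ** (M ** N)"
    by (simp add: right matrix_mul_assoc)
  also have "\<dots> = N'"
    by (simp add: left matrix_mul_assoc)
  finally show ?thesis .
qed

text \<open>A Hermitian \<open>M\<close> is injective on its range, so some \<open>K\<close> satisfies \<open>K M\<^sup>2 = M\<close>; then
  \<open>K M = K M\<^sup>2 K\<^sup>* = M K\<^sup>*\<close> is the orthogonal projection onto the range of \<open>M\<close>.\<close>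

lemma hermitian_ex_mp_inverse:
  fixes M :: "complex^'n^'n"
  assumes "hermitian M"
  shows "\<exists>N. is_mp_inverse M N"
proof -
  have M: "conj_transpose M = M"
    using assms by (simp add: hermitian_def)
  \<comment> \<open>Since \<open>M\<close> is self-adjoint, the squared norm of
    \<open>M *v x\<close> is the inner product of \<open>M *v (M *v x)\<close> with
    \<open>x\<close>.\<close>
  have kernel: "M *v x = 0" if "M *v (M *v x) = 0" for x
    using inner_matrix_vector_mult[of "M *v x" M x] that by (simp add: M)
  have "inj_on ((*v) M) (range ((*v) M))"
  proof (rule inj_onI, clarsimp)
    fix x y assume "M *v (M *v x) = M *v (M *v y)"
    then have "M *v (M *v (x - y)) = 0"
      by (simp add: matrix_vector_mult_diff_distrib)
    from kernel[OF this] show "M *v x = M *v y"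
      by (simp add: matrix_vector_mult_diff_distrib)
  qed
  moreover have "vec.subspace (range ((*v) M))"
    by (intro vec.subspace_image vec.subspace_UNIV matrix_vector_mul_linear_gen)
  ultimately obtain g where g: "Vector_Spaces.linear (*s) (*s) g"
      "\<And>v. v \<in> range ((*v) M) \<Longrightarrow> g (M *v v) = v"
    using vec.linear_exists_left_inverse_on[OF matrix_vector_mul_linear_gen] by blast
  define K where "K = matrix g"
  have "K ** (M ** M) = M"
    unfolding matrix_eq
    by (simp add: K_def matrix_works[OF g(1)] g(2) flip: matrix_vector_mul_assoc)
  then have KMM: "K ** M ** M = M"
    by (simp add: matrix_mul_assoc)
  define L where "L = conj_transpose K"
  have MML: "M ** M ** L = M"
    using arg_cong[OF KMM, of conj_transpose]
    by (simp add: conj_transpose_mult M L_def matrix_mul_assoc)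
  define E where "E = K ** M"
  have EL: "E = M ** L"
    by (metis E_def KMM MML matrix_mul_assoc)
  have E: "conj_transpose E = E"
    by (simp add: EL conj_transpose_mult M L_def flip: E_def)
  have EM: "E ** M = M"
    by (simp add: E_def KMM)
  have ME: "M ** E = M"
    by (simp add: EL matrix_mul_assoc MML)
  have EE: "E ** E = E"
    by (metis EL EM matrix_mul_assoc)
  \<comment> \<open>This is \<open>E ** L\<close>: the projection \<open>E\<close> in front secures
    \<open>N ** M ** N = N\<close>, while \<open>M ** L = E\<close> settles the products with
    \<open>M\<close>.\<close>
  define N where "N = K ** M ** L"
  have MN: "M ** N = E"
    by (metis N_def E_def EL ME matrix_mul_assoc)
  have NM: "N ** M = E"
    by (metis N_def E_def EL EM matrix_mul_assoc)
  have EN: "E ** N = N"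
    by (metis N_def E_def EE matrix_mul_assoc)
  have "is_mp_inverse M N"
    by (simp add: is_mp_inverse_def MN NM EM EN E)
  then show ?thesis ..
qed

lemma is_mp_inverse_mp_inverse:
  assumes "hermitian M"
  shows "is_mp_inverse M (mp_inverse M)"
  unfolding mp_inverse_def
  by (rule theI') (use hermitian_ex_mp_inverse[OF assms] is_mp_inverse_unique in blast)

text \<open>With P = A + B and N its Moore-Penrose inverse, both N P and P N are right units for P,
  hence for B by the kernel inclusion. The second claim is the adjoint of the case P N.\<close>

lemma mp_inverse_add_absorb:
  fixes A B :: "complex^'n^'n"
  assumes "hermitian_psd A" "hermitian_psd B"
  shows "B ** mp_inverse (A + B) ** (A + B) = B"
    and "(A + B) ** mp_inverse (A + B) ** B = B"
proof -
  define P where "P = A + B"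
  define N where "N = mp_inverse P"
  have herm: "conj_transpose P = P" "conj_transpose B = B"
    using hermitian_psd_add[OF assms] assms(2)
    by (auto simp: P_def hermitian_psd_def hermitian_def)
  then have N: "P ** N ** P = P" "conj_transpose (P ** N) = P ** N"
    using is_mp_inverse_mp_inverse[of P] by (auto simp: N_def hermitian_def is_mp_inverse_def)
  have absorb: "B ** Z = B" if "P ** Z = P" for Z
    using hermitian_psd_add_mult_eq_0[OF assms, of "Z - mat 1"] that
    by (simp add: matrix_diff_ldistrib P_def)
  show "B ** mp_inverse (A + B) ** (A + B) = B"
    using absorb[of "N ** P"] N(1) by (simp add: matrix_mul_assoc P_def N_def)
  have "P ** (P ** N) = P"
    using arg_cong[OF N(1), of conj_transpose] conj_transpose_mult[of "P ** N" P]
    by (simp add: N(2) herm)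
  from arg_cong[OF absorb[OF this], of conj_transpose]
  show "(A + B) ** mp_inverse (A + B) ** B = B"
    by (simp only: conj_transpose_mult[of B "P ** N"] N(2) herm flip: P_def N_def)
qed

section \<open>Parallel sums and the identity\<close>

lemma parallel_sum_eq:
  fixes A B :: "complex^'n^'n"
  assumes "hermitian_psd A" "hermitian_psd B"
  shows "parallel_sum A B = B - B ** mp_inverse (A + B) ** B"
proof -
  have "parallel_sum A B = ((A + B) - B) ** mp_inverse (A + B) ** B"
    by (simp add: parallel_sum_def)
  also have "\<dots> = B - B ** mp_inverse (A + B) ** B"
    by (simp only: matrix_diff_rdistrib mp_inverse_add_absorb[OF assms])
  finally show ?thesis .
qed

lemma parallel_sum_eq':
  fixes A B :: "complex^'n^'n"
  assumes "hermitian_psd A" "hermitian_psd B"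
  shows "parallel_sum A B = A - A ** mp_inverse (A + B) ** A"
proof -
  have "parallel_sum A B = A ** mp_inverse (A + B) ** ((A + B) - A)"
    by (simp add: parallel_sum_def)
  also have "\<dots> = A - A ** mp_inverse (A + B) ** A"
    using mp_inverse_add_absorb(1)[OF assms(2,1)]
    by (simp only: matrix_diff_ldistrib add.commute)
  finally show ?thesis .
qed

lemma parallel_sum_commute:
  fixes A B :: "complex^'n^'n"
  assumes "hermitian_psd A" "hermitian_psd B"
  shows "parallel_sum A B = parallel_sum B A"
  using parallel_sum_eq[OF assms] parallel_sum_eq'[OF assms(2,1)] by (simp add: add.commute)

theorem theorem3p1:
  fixes A B X Y T H :: "complex^'n^'n"
  assumes "hermitian_psd A" and "hermitian_psd B"
    and "hermitian_psd X" and "hermitian_psd Y"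
    and "T = parallel_sum (A + B) (X + Y)"
    and "H = parallel_sum (A + X) (B + Y) - parallel_sum A B - parallel_sum X Y"
  shows "H =
    conj_transpose (mp_inverse (A + B) ** B - mp_inverse (X + Y) ** Y) ** T **
      (mp_inverse (A + B) ** B - mp_inverse (X + Y) ** Y)"
proof -
  define P Q where "P = A + B" and "Q = X + Y"
  define C D where "C = mp_inverse P ** B" and "D = mp_inverse Q ** Y"
  define S where "S = mp_inverse (P + Q)"
  have psd: "hermitian_psd P" "hermitian_psd Q" "hermitian_psd (A + X)" "hermitian_psd (B + Y)"
    using assms(1-4) by (auto simp: P_def Q_def intro: hermitian_psd_add)
  then have herm: "conj_transpose P = P" "conj_transpose Q = Q"
      "conj_transpose B = B" "conj_transpose Y = Y"
    using assms(2,4) by (auto simp: hermitian_psd_def hermitian_def)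
  have PC: "P ** C = B" and QD: "Q ** D = Y"
    using mp_inverse_add_absorb(2)[OF assms(1,2)] mp_inverse_add_absorb(2)[OF assms(3,4)]
    by (simp_all add: P_def Q_def C_def D_def matrix_mul_assoc)
  have CP: "conj_transpose C ** P = B" and DQ: "conj_transpose D ** Q = Y"
    using arg_cong[OF PC, of conj_transpose] arg_cong[OF QD, of conj_transpose]
    by (simp_all add: conj_transpose_mult herm)
  \<comment> \<open>Each form has outer factors suited to one of the four products below:
    \<open>C\<close> needs a neighbouring \<open>P\<close>, and \<open>D\<close> a neighbouring
    \<open>Q\<close>.\<close>
  have T: "T = P - P ** S ** P" "T = Q - Q ** S ** Q" "T = P ** S ** Q" "T = Q ** S ** P"
    using parallel_sum_eq[OF psd(1,2)] parallel_sum_eq'[OF psd(1,2)]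
      parallel_sum_commute[OF psd(1,2)]
    by (simp_all add: assms(5) P_def Q_def S_def parallel_sum_def add.commute)
  have CTC: "conj_transpose C ** T ** C = B ** C - B ** S ** B"
    by (simp add: T(1) matrix_diff_ldistrib matrix_diff_rdistrib matrix_mul_assoc CP)
      (simp add: PC flip: matrix_mul_assoc)
  have DTD: "conj_transpose D ** T ** D = Y ** D - Y ** S ** Y"
    by (simp add: T(2) matrix_diff_ldistrib matrix_diff_rdistrib matrix_mul_assoc DQ)
      (simp add: QD flip: matrix_mul_assoc)
  have CTD: "conj_transpose C ** T ** D = B ** S ** Y"
    by (simp add: T(3) matrix_mul_assoc CP) (simp add: QD flip: matrix_mul_assoc)
  have DTC: "conj_transpose D ** T ** C = Y ** S ** B"
    by (simp add: T(4) matrix_mul_assoc DQ) (simp add: PC flip: matrix_mul_assoc)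
  \<comment> \<open>The same \<open>S\<close> appears here as in \<open>T\<close> because (A + X) +
    (B + Y) = P + Q.\<close>
  have "parallel_sum (A + X) (B + Y) = (B + Y) - (B + Y) ** S ** (B + Y)"
    using parallel_sum_eq[OF psd(3,4)] by (simp add: S_def P_def Q_def algebra_simps)
  moreover have "parallel_sum A B = B - B ** C" "parallel_sum X Y = Y - Y ** D"
    using parallel_sum_eq assms(1-4) by (simp_all add: C_def D_def P_def Q_def matrix_mul_assoc)
  ultimately have "H = B ** C + Y ** D - (B + Y) ** S ** (B + Y)"
    by (simp add: assms(6))
  also have "\<dots> = conj_transpose (C - D) ** T ** (C - D)"
    by (simp add: conj_transpose_diff matrix_diff_ldistrib matrix_diff_rdistrib
        matrix_add_ldistrib matrix_add_rdistrib CTC DTD CTD DTC)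
  finally show ?thesis
    by (simp add: C_def D_def P_def Q_def)
qed

end
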